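(* Let $u$ be a finite sequence with exactly $r$ distinct letters that is strongly irreducible and in which each of its letters occurs more than once. Let $a_1,\dots,a_{r-1}$ be $r-1$ distinct letters, none of which belongs to $\mathbb{Z}$. Then there exists a doubly infinite sequence over the alphabet $\{a_1,\dots,a_{r-1}\}\cup\mathbb{Z}$ that is $u$-saturated.
   Context: A sequence $u$ is strongly irreducible if for any two distinct letters $\alpha,\beta$ of $u$, it is not the case that all occurrences of $\alpha$ in $u$ come before all occurrences of $\beta$, nor vice versa. A doubly infinite sequence over an alphabet $A$ is a family $(s_k)_{k\in\mathbb{Z}}$ of letters of $A$. Two sequences are isomorphic if one is obtained from the other by a one-to-one renaming of letters. A copy of $u$ in $s$ is a (not necessarily contiguous) subsequence of $s$ isomorphic to $u$. A (possibly infinite) sequence is $r$-sparse if any $r$ consecutive letters in it are pairwise distinct. A doubly infinite sequence $s$ over a (possibly infinite) alphabet $A$ is $u$-saturated if $s$ is $r$-sparse (where $r$ is the number of distinct letters of $u$), $s$ contains no copy of $u$, and inserting any letter of $A$ between two consecutive letters of $s$ yields a sequence that is not $r$-sparse or that contains a copy of $u$. *)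

theory Defs
  imports Main
begin

definition all_before :: "'b list \<Rightarrow> 'b \<Rightarrow> 'b \<Rightarrow> bool" where
  "all_before u \<alpha> \<beta> \<longleftrightarrow>
     (\<forall>i < length u. \<forall>j < length u. u ! i = \<alpha> \<and> u ! j = \<beta> \<longrightarrow> i < j)"

definition strongly_irreducible :: "'b list \<Rightarrow> bool" where
  "strongly_irreducible u \<longleftrightarrow>
     (\<forall>\<alpha> \<in> set u. \<forall>\<beta> \<in> set u. \<alpha> \<noteq> \<beta> \<longrightarrow> \<not> all_before u \<alpha> \<beta> \<and> \<not> all_before u \<beta> \<alpha>)"

definition isomorphic :: "'b list \<Rightarrow> 'a list \<Rightarrow> bool" where
  "isomorphic u v \<longleftrightarrow> (\<exists>f. inj_on f (set u) \<and> v = map f u)"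

text \<open>A doubly infinite sequence is a function on the integers.  The list \<open>v\<close> is a (not necessarily
  contiguous) subsequence of \<open>s\<close> if it is read off at strictly increasing positions.\<close>

definition subsequence :: "'a list \<Rightarrow> (int \<Rightarrow> 'a) \<Rightarrow> bool" where
  "subsequence v s \<longleftrightarrow>
     (\<exists>p :: nat \<Rightarrow> int. strict_mono_on {..<length v} p \<and> (\<forall>i < length v. v ! i = s (p i)))"

definition contains_copy :: "'b list \<Rightarrow> (int \<Rightarrow> 'a) \<Rightarrow> bool" where
  "contains_copy u s \<longleftrightarrow> (\<exists>v. subsequence v s \<and> isomorphic u v)"

definition sparse :: "nat \<Rightarrow> (int \<Rightarrow> 'a) \<Rightarrow> bool" where
  "sparse r s \<longleftrightarrow> (\<forall>k. inj_on s {k..<k + int r})"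

text \<open>Insertion of \<open>x\<close> between the consecutive letters \<open>s k\<close> and \<open>s (k + 1)\<close>.\<close>

definition insert_after :: "(int \<Rightarrow> 'a) \<Rightarrow> int \<Rightarrow> 'a \<Rightarrow> int \<Rightarrow> 'a" where
  "insert_after s k x = (\<lambda>i. if i \<le> k then s i else if i = k + 1 then x else s (i - 1))"

definition saturated :: "'b list \<Rightarrow> 'a set \<Rightarrow> (int \<Rightarrow> 'a) \<Rightarrow> bool" where
  "saturated u A s \<longleftrightarrow>
     range s \<subseteq> A \<and>
     sparse (card (set u)) s \<and>
     \<not> contains_copy u s \<and>
     (\<forall>k. \<forall>x \<in> A. \<not> sparse (card (set u)) (insert_after s k x) \<or>
                   contains_copy u (insert_after s k x))"

end

theory Submission
  imports Defs
begin

text \<open>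
  Lay out the letters \<open>a\<^sub>1, \<dots>, a\<^sub>r\<^sub>-\<^sub>1\<close> periodically with period \<open>r\<close>, leaving free the multiples of
  \<open>r\<close>, and fill the free places with integer letters, each integer filling \<open>m\<close> consecutive free
  places, in increasing order.  All occurrences of one integer then precede all occurrences of any
  larger one, so a copy of the strongly irreducible \<open>u\<close> uses at most one integer \<open>n\<close>.  Whether there
  is such a copy is a question on the single number \<open>m\<close>: can \<open>u\<close> be read off the periodic pattern
  if one more letter is available in \<open>m\<close> consecutive free places and nothing in the others?  This is
  \<open>fits_run u r m\<close>.  It fails for \<open>m \<le> 1\<close>, because every letter of \<open>u\<close> is repeated and all \<open>r\<close>
  letters of the pattern are needed, and it holds for \<open>m = length u\<close>, where the letters of \<open>u\<close>
  can be read off one per period.  So there is \<open>m \<ge> 1\<close> with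
  \<open>\<not> fits_run u r m\<close> and \<open>fits_run u r (m + 1)\<close>; this \<open>m\<close> is the one to take.

  The sequence is saturated because the pattern is as tight as sparsity allows.  An inserted
  \<open>a\<^sub>i\<close> always lands too close to another \<open>a\<^sub>i\<close>.  An inserted integer \<open>n\<close> respects sparsity
  only if a full round \<open>a\<^sub>1, \<dots>, a\<^sub>r\<^sub>-\<^sub>1\<close> separates it from the \<open>m\<close> old places of \<open>n\<close> (or if
  \<open>r = 1\<close>, where there is nothing to separate).  Together with them it forms a run of
  \<open>m + 1\<close> places, with infinitely many rounds still available on either side, and hence a copy
  of \<open>u\<close> appears (\<open>contains_copy_if_run\<close>).
\<close>

section \<open>Words with a periodic frame\<close>

definition framed :: "(nat \<Rightarrow> 'a) \<Rightarrow> nat \<Rightarrow> (int \<Rightarrow> 'a) \<Rightarrow> int \<Rightarrow> 'a" where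
  "framed a r z k = (if int r dvd k then z (k div int r) else a (nat (k mod int r)))"

lemma nat_mod_in_frame:
  assumes "0 < r" "\<not> int r dvd k"
  shows "nat (k mod int r) \<in> {1..r - 1}"
proof -
  have "k mod int r \<noteq> 0" using assms(2) by (simp add: dvd_eq_mod_eq_0)
  moreover have "0 \<le> k mod int r" "k mod int r < int r" using assms(1) by simp_all
  ultimately show ?thesis by (auto simp: nat_le_iff)
qed

lemma framed_eqD:
  assumes r: "0 < r" and inj: "inj_on a {1..r - 1}" and disj: "\<forall>i \<in> {1..r - 1}. a i \<notin> range \<iota>"
    and eq: "framed a r (\<lambda>q. \<iota> (f q)) k = framed a r (\<lambda>q. \<iota> (g q)) l"
  shows "k mod int r = l mod int r"
proof -
  have ne: "a (nat (j mod int r)) \<noteq> \<iota> y" if "\<not> int r dvd j" for j y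
    using disj nat_mod_in_frame[OF r that] by (metis rangeI)
  have dvd: "int r dvd k \<longleftrightarrow> int r dvd l"
    using eq ne ne[THEN not_sym] by (auto simp: framed_def split: if_splits)
  show ?thesis
  proof (cases "int r dvd k")
    case True
    then show ?thesis using dvd by (simp add: dvd_eq_mod_eq_0)
  next
    case False
    then have "a (nat (k mod int r)) = a (nat (l mod int r))"
      using dvd eq by (simp add: framed_def)
    then have "nat (k mod int r) = nat (l mod int r)"
      using inj nat_mod_in_frame[OF r] False dvd by (meson inj_onD)
    then show ?thesis using r by (simp add: nat_eq_iff)
  qed
qed

lemma range_framed_subset:
  assumes "0 < r"
  shows "range (framed a r z) \<subseteq> a ` {1..r - 1} \<union> range z"
  using nat_mod_in_frame[OF assms] by (auto simp: framed_def)

lemma sparse_framed: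
  assumes "0 < r" "inj_on a {1..r - 1}" "\<forall>i \<in> {1..r - 1}. a i \<notin> range \<iota>"
  shows "sparse r (framed a r (\<lambda>q. \<iota> (f q)))"
  unfolding sparse_def
proof (intro allI inj_onI)
  fix k i j assume i: "i \<in> {k..<k + int r}" and j: "j \<in> {k..<k + int r}"
    and "framed a r (\<lambda>q. \<iota> (f q)) i = framed a r (\<lambda>q. \<iota> (f q)) j"
  then have "(i - j) mod int r = 0"
    using framed_eqD[OF assms] by (metis mod_eq_dvd_iff dvd_eq_mod_eq_0)
  then have "int r dvd i - j" by auto
  moreover have "\<bar>i - j\<bar> < int r" using i j by auto
  ultimately have "i - j = 0" by (metis abs_of_nat dvd_imp_le_int not_le)
  then show "i = j" by simp
qed

section \<open>Words that fit a run of one letter\<close>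

text \<open>
  Here \<open>f\<close> names each letter of \<open>u\<close> by its residue in the pattern, \<open>0\<close> being the name of the
  letter of the run; a free place outside the run cannot be used at all.
\<close>

definition fits_run :: "'b list \<Rightarrow> nat \<Rightarrow> nat \<Rightarrow> bool" where
  "fits_run u r M \<longleftrightarrow> (\<exists>f p. inj_on f (set u) \<and> strict_mono_on {..<length u} p \<and>
     (\<forall>i < length u. p i mod int r = f (u ! i) \<and>
        (int r dvd p i \<longrightarrow> 0 \<le> p i \<and> p i < int r * int M)))"

text \<open>
  As \<open>u\<close> has \<open>r\<close> letters, one of them is named \<open>0\<close>; it occurs at least
  twice, whereas the run has at most one place.
\<close>

lemma not_fits_run_le_one:
  assumes u: "u \<noteq> []" and r: "card (set u) = r" and rep: "\<forall>x \<in> set u. count_list u x > 1"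
    and M: "M \<le> 1"
  shows "\<not> fits_run u r M"
proof
  assume "fits_run u r M"
  then obtain f p where f: "inj_on f (set u)" and p: "strict_mono_on {..<length u} p"
    and fp: "\<And>i. i < length u \<Longrightarrow> p i mod int r = f (u ! i)"
    and run: "\<And>i. i < length u \<Longrightarrow> int r dvd p i \<Longrightarrow> 0 \<le> p i \<and> p i < int r * int M"
    unfolding fits_run_def by blast
  have r0: "0 < r" using u r by (metis card_gt_0_iff finite_set set_empty)
  have "f ` set u \<subseteq> {0..<int r}"
    using fp r0 by (auto simp: in_set_conv_nth simp flip: fp)
  moreover have "card (f ` set u) = card {0..<int r}" using card_image[OF f] r by simp
  ultimately have "f ` set u = {0..<int r}" by (intro card_subset_eq) auto
  then obtain x where x: "x \<in> set u" "f x = 0" using r0 by (metis (no_types) atLeastLessThan_iff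
    imageE of_nat_0_less_iff order_refl)
  have zero: "p i = 0" if "i < length u" "u ! i = x" for i
  proof -
    have "int r dvd p i" using fp that x by (metis mod_0_imp_dvd)
    moreover from run[OF that(1) this] have "0 \<le> p i" "p i < int r"
      using M by (auto simp: le_Suc_eq)
    ultimately show ?thesis by (metis zdvd_not_zless order_le_less)
  qed
  let ?I = "{i. i < length u \<and> x = u ! i}"
  have "card ?I > 1"
    using rep x by (simp add: count_list_eq_length_filter length_filter_conv_card)
  then obtain i j where ij: "i \<in> ?I" "j \<in> ?I" "i \<noteq> j"
    using card_le_Suc0_iff_eq[of ?I] by fastforce
  have "inj_on p {..<length u}" using p by (rule strict_mono_on_imp_inj_on)
  moreover have "p i = p j" using zero ij by simp
  ultimately show False using ij by (auto dest: inj_onD)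
qed

lemma fits_run_length:
  assumes "u \<noteq> []" "card (set u) = r"
  shows "fits_run u r (length u)"
proof -
  have r0: "0 < r" using assms by (metis card_gt_0_iff finite_set set_empty)
  have "card (set u) = card {0..<int r}" using assms by simp
  then obtain f where f: "bij_betw f (set u) {0..<int r}"
    by (metis finite_same_card_bij finite_set finite_atLeastLessThan_int)
  have f01: "0 \<le> f (u ! i)" "f (u ! i) < int r" if "i < length u" for i
    using bij_betwE[OF f] that by auto
  define p where "p i = int r * int i + f (u ! i)" for i
  have "strict_mono_on {..<length u} p"
  proof (rule strict_mono_onI)
    fix i j assume ij: "i \<in> {..<length u}" "j \<in> {..<length u}" "i < j"
    have "int r * (int i + 1) \<le> int r * int j" using ij by (intro mult_left_mono) auto
    then show "p i < p j" using f01[of i] f01[of j] ij by (simp add: p_def algebra_simps)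
  qed
  moreover have "p i mod int r = f (u ! i)" if "i < length u" for i
    using f01[OF that] by (simp add: p_def)
  moreover have "0 \<le> p i \<and> p i < int r * int (length u)" if "i < length u" for i
  proof -
    have "int r * (int i + 1) \<le> int r * int (length u)" using that by (intro mult_left_mono) auto
    then show ?thesis using f01[OF that] by (simp add: p_def algebra_simps)
  qed
  ultimately show ?thesis using bij_betw_imp_inj_on[OF f] unfolding fits_run_def by blast
qed

lemma exists_maximal_unfit_run:
  assumes "u \<noteq> []" "card (set u) = r" "\<forall>x \<in> set u. count_list u x > 1"
  obtains m where "0 < m" "\<not> fits_run u r m" "fits_run u r (Suc m)"
proof -
  define M where "M = (LEAST M. fits_run u r M)"
  have fits: "fits_run u r M" unfolding M_def using fits_run_length[OF assms(1,2)] by (rule LeastI)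
  then have "1 < M" using not_fits_run_le_one[OF assms] by (meson not_le)
  moreover have "\<not> fits_run u r (M - 1)"
    using not_less_Least[of "M - 1" "fits_run u r"] \<open>1 < M\<close> by (simp add: M_def)
  ultimately show thesis using that[of "M - 1"] fits by simp
qed

section \<open>Copies in framed words\<close>

text \<open>
  The places available to a word that fits a run are the domain on which \<open>e\<close> has to be specified:
  \<open>e\<close> transports the abstract run of the letter \<open>c\<close>, with its frame, into \<open>t\<close>.
\<close>

lemma contains_copy_if_run:
  assumes r: "0 < r" and inj: "inj_on a {1..r - 1}" and c: "\<forall>i \<in> {1..r - 1}. a i \<noteq> c"
    and fits: "fits_run u r M"
    and mono: "strict_mono_on {j. int r dvd j \<longrightarrow> 0 \<le> j \<and> j < int r * int M} e"
    and t: "\<And>j. (int r dvd j \<Longrightarrow> 0 \<le> j \<and> j < int r * int M) \<Longrightarrow> t (e j) = framed a r (\<lambda>_. c) j"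
  shows "contains_copy u t"
proof -
  let ?w = "framed a r (\<lambda>_. c)"
  obtain f p where f: "inj_on f (set u)" and p: "strict_mono_on {..<length u} p"
    and fp: "\<And>i. i < length u \<Longrightarrow> p i mod int r = f (u ! i)"
    and run: "\<And>i. i < length u \<Longrightarrow> int r dvd p i \<Longrightarrow> 0 \<le> p i \<and> p i < int r * int M"
    using fits unfolding fits_run_def by blast
  have w_mod: "?w (k mod int r) = ?w k" for k
    by (simp add: framed_def dvd_eq_mod_eq_0)
  have "inj_on (?w \<circ> f) (set u)"
  proof (rule inj_onI)
    fix x y assume xy: "x \<in> set u" "y \<in> set u" and eq: "(?w \<circ> f) x = (?w \<circ> f) y"
    have red: "f x mod int r = f x" if "x \<in> set u" for x
      using that fp by (metis in_set_conv_nth mod_mod_trivial)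
    have "f x mod int r = f y mod int r"
      using framed_eqD[OF r inj, of "\<lambda>_. c" "\<lambda>_. 0" "f x" "\<lambda>_. 0" "f y"] c eq by auto
    then show "x = y" using red xy f by (metis inj_onD)
  qed
  moreover have "subsequence (map (?w \<circ> f) u) t"
  proof -
    have "strict_mono_on {..<length u} (e \<circ> p)"
    proof (rule strict_mono_onI)
      fix i j assume ij: "i \<in> {..<length u}" "j \<in> {..<length u}" "i < j"
      then have "p i < p j" by (rule strict_mono_onD[OF p])
      then show "(e \<circ> p) i < (e \<circ> p) j"
        using ij run strict_mono_onD[OF mono, of "p i" "p j"] by simp
    qed
    moreover have "(?w \<circ> f) (u ! i) = t (e (p i))" if "i < length u" for i
    proof -
      have "t (e (p i)) = ?w (p i)" using t run that by blast
      then show ?thesis using fp[OF that] w_mod[of "p i"] by simp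
    qed
    ultimately show ?thesis unfolding subsequence_def by (intro exI[of _ "e \<circ> p"]) auto
  qed
  ultimately show ?thesis unfolding contains_copy_def isomorphic_def by blast
qed

text \<open>
  Two different integers used by a copy would contradict strong irreducibility, so
  the copy is confined to one run, which a shift moves to the origin.
\<close>

lemma no_copy_in_framed_runs:
  assumes r: "0 < r" and inj: "inj_on a {1..r - 1}" and disj: "\<forall>i \<in> {1..r - 1}. a i \<notin> range \<iota>"
    and \<iota>: "inj \<iota>" and irr: "strongly_irreducible u" and m: "0 < m" and unfit: "\<not> fits_run u r m"
  shows "\<not> contains_copy u (framed a r (\<lambda>q. \<iota> (q div int m)))" (is "\<not> contains_copy u ?s")
proof
  assume "contains_copy u ?s"
  then obtain g p where g: "inj_on g (set u)" and p: "strict_mono_on {..<length u} p"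
    and gp: "\<And>i. i < length u \<Longrightarrow> g (u ! i) = ?s (p i)"
    unfolding contains_copy_def subsequence_def isomorphic_def by auto
  define N where "N k = k div int r div int m" for k
  have s_free: "?s k = \<iota> (N k)" if "int r dvd k" for k
    using that by (simp add: framed_def N_def)
  have same_letter: "int r dvd p i' \<and> N (p i') = N (p i)"
    if "i < length u" "i' < length u" "u ! i' = u ! i" "int r dvd p i" for i i'
  proof -
    have eq: "?s (p i') = ?s (p i)" using gp that by metis
    then have "int r dvd p i'"
      using framed_eqD[OF r inj disj] that(4) by (metis dvd_eq_mod_eq_0)
    then show ?thesis using eq s_free that(4) injD[OF \<iota>] by metis
  qed
  have not_less: "\<not> N (p i) < N (p j)"
    if i: "i < length u" "int r dvd p i" and j: "j < length u" "int r dvd p j" for i j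
  proof
    assume less: "N (p i) < N (p j)"
    have "i' < j'" if "i' < length u" "j' < length u" "u ! i' = u ! i" "u ! j' = u ! j" for i' j'
    proof -
      have "N (p i') < N (p j')" using same_letter i j that less by metis
      then have "p i' < p j'" unfolding N_def using r m
        by (meson not_le zdiv_mono1 of_nat_0_less_iff)
      then show ?thesis using p that
        by (metis lessThan_iff linorder_neqE_nat order_less_asym strict_mono_onD)
    qed
    then have "all_before u (u ! i) (u ! j)" unfolding all_before_def by blast
    moreover have "u ! i \<noteq> u ! j" using same_letter i j less by (metis less_irrefl)
    ultimately show False using irr i j unfolding strongly_irreducible_def by (meson nth_mem)
  qed
  obtain n where n: "\<And>i. i < length u \<Longrightarrow> int r dvd p i \<Longrightarrow> N (p i) = n"
    using not_less by (metis linorder_neqE)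
  \<comment> \<open>The shift by the \<open>r m n\<close> places before the run of \<open>n\<close> preserves residues modulo \<open>r\<close>.\<close>
  define p' where "p' i = p i - int r * (int m * n)" for i
  have p'_mod: "p' i mod int r = p i mod int r" for i
    by (simp add: p'_def mod_diff_eq flip: mod_diff_right_eq)
  have "\<exists>f. \<forall>x \<in> set u. \<forall>i < length u. u ! i = x \<longrightarrow> f x = p i mod int r"
  proof (intro exI ballI allI impI)
    fix x i assume i: "i < length u" "u ! i = x"
    let ?P = "\<lambda>j. j < length u \<and> u ! j = x"
    have "?P (SOME j. ?P j)" using i by (intro someI[of ?P i]) simp
    then show "p (SOME j. ?P j) mod int r = p i mod int r"
      using framed_eqD[OF r inj disj] gp i by metis
  qed
  then obtain f where f: "\<And>i. i < length u \<Longrightarrow> f (u ! i) = p i mod int r" by (metis nth_mem)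
  have "inj_on f (set u)"
  proof (rule inj_onI)
    fix x y assume "x \<in> set u" "y \<in> set u" and eq: "f x = f y"
    then obtain i j where i: "i < length u" "u ! i = x" and j: "j < length u" "u ! j = y"
      by (metis in_set_conv_nth)
    have mods: "p i mod int r = p j mod int r" using f i j eq by metis
    have "?s (p i) = ?s (p j)"
    proof (cases "int r dvd p i")
      case True
      then have "int r dvd p j" using mods by (simp add: dvd_eq_mod_eq_0)
      then show ?thesis using True s_free n i j by metis
    next
      case False
      then show ?thesis using mods by (simp add: framed_def dvd_eq_mod_eq_0)
    qed
    then have "g x = g y" using gp i j by metis
    then show "x = y" using g \<open>x \<in> set u\<close> \<open>y \<in> set u\<close> by (meson inj_onD)
  qed
  moreover have "strict_mono_on {..<length u} p'"
    using p by (auto simp: p'_def strict_mono_on_def)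
  moreover have "0 \<le> p' i \<and> p' i < int r * int m" if "i < length u" "int r dvd p' i" for i
  proof -
    have "int r dvd p i" using that(2) p'_mod[of i] by (simp add: dvd_eq_mod_eq_0)
    then have "n = p i div (int r * int m)" using n that(1) by (simp add: N_def zdiv_zmult2_eq)
    then have "p' i = p i mod (int r * int m)"
      by (simp add: p'_def minus_mult_div_eq_mod[symmetric] algebra_simps)
    then show ?thesis using r m by simp
  qed
  ultimately have "fits_run u r m" unfolding fits_run_def using f p'_mod by metis
  with unfit show False ..
qed

section \<open>Inserting a letter\<close>

lemma sparse_distance:
  assumes "sparse r t" "i < j" "t i = t j"
  shows "int r \<le> j - i"
proof (rule ccontr)
  assume "\<not> int r \<le> j - i"
  then have "i \<in> {i..<i + int r}" "j \<in> {i..<i + int r}" using assms(2) by auto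
  then show False using assms unfolding sparse_def by (metis inj_onD less_irrefl)
qed

lemma sparse_insert_distance:
  assumes "sparse r (insert_after s k (s q))"
  shows "q \<le> k \<Longrightarrow> int r \<le> k + 1 - q" and "k < q \<Longrightarrow> int r \<le> q - k"
  using sparse_distance[OF assms, of q "k + 1"] sparse_distance[OF assms, of "k + 1" "q + 1"]
  by (auto simp: insert_after_def)

text \<open>
  The distances from the new letter to the old ones on its two sides add up to \<open>r + 1\<close>, and
  sparsity requires each of them to be at least \<open>r\<close>.
\<close>

lemma sparse_insert_between:
  assumes "sparse r (insert_after s k x)" "s q = x" "s (q + int r) = x" "q \<le> k" "k < q + int r"
  shows "r \<le> 1"
  using sparse_insert_distance[of r s k q] sparse_insert_distance[of r s k "q + int r"] assms
  by auto

lemma not_sparse_insert_frame_letter: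
  assumes "i \<in> {1..r - 1}"
  shows "\<not> sparse r (insert_after (framed a r z) k (a i))"
proof
  assume sp: "sparse r (insert_after (framed a r z) k (a i))"
  define q where "q = k - (k - int i) mod int r"
  have r: "0 < int r" and ir: "0 < int i" "int i < int r" using assms by auto
  have "q mod int r = int i mod int r" unfolding q_def by (simp add: mod_diff_right_eq)
  then have q: "q mod int r = int i" using ir by simp
  have s: "framed a r z l = a i" if "l mod int r = int i" for l
    using that ir by (simp add: framed_def dvd_eq_mod_eq_0)
  have "0 \<le> (k - int i) mod int r" "(k - int i) mod int r < int r" using r by simp_all
  then have "r \<le> 1" using sparse_insert_between[OF sp s[of q] s[of "q + int r"]] q
    by (simp add: q_def)
  then show False using ir by simp
qed

text \<open>
  If \<open>r > 1\<close>, sparsity keeps the new \<open>\<iota> n\<close> at distance at least \<open>r\<close> from the old ones, and it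
  cannot lie between two of them.  It then serves as the last or the first place of a run of
  length \<open>m + 1\<close>, and the frame beyond it is reached by skipping sufficiently many periods.  If
  \<open>r = 1\<close>, there is no frame, and the new letter may also lie inside the old run.
\<close>

lemma insert_run_letter_contains_copy:
  assumes r: "0 < r" and inj: "inj_on a {1..r - 1}" and disj: "\<forall>i \<in> {1..r - 1}. a i \<notin> range \<iota>"
    and m: "0 < m" and fits: "fits_run u r (Suc m)"
    and sp: "sparse r (insert_after (framed a r (\<lambda>q. \<iota> (q div int m))) k (\<iota> n))"
      (is "sparse r (insert_after ?s k _)")
  shows "contains_copy u (insert_after ?s k (\<iota> n))" (is "contains_copy u ?t")
proof -
  \<comment> \<open>The old places of \<open>\<iota> n\<close> are the multiples of \<open>r\<close> in the interval from \<open>S\<close> to \<open>E - 1\<close>.\<close>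
  define S where "S = int r * (int m * n)"
  define E where "E = S + int r * int m"
  let ?w = "framed a r (\<lambda>_. \<iota> n)"
  have run: "?s (S + j) = ?w j" if "int r dvd j \<Longrightarrow> 0 \<le> j \<and> j < int r * int m" for j
  proof (cases "int r dvd j")
    case True
    then obtain q where q: "j = int r * q" by blast
    have "0 \<le> q" "q < int m" using that True q r by (auto simp: zero_le_mult_iff)
    then have "(int m * n + q) div int m = n" using m by simp
    moreover have "(S + j) div int r = int m * n + q"
      using r by (simp add: S_def q flip: distrib_left)
    ultimately show ?thesis using True by (simp add: framed_def S_def)
  next
    case False
    then show ?thesis by (simp add: framed_def S_def dvd_eq_mod_eq_0)
  qed
  have frame: "?s (S + j + int r * C) = ?w j" if "\<not> int r dvd j" for j C
  proof -
    have "(S + j + int r * C) mod int r = j mod int r" by (simp add: S_def)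
    then show ?thesis using that by (simp add: framed_def dvd_eq_mod_eq_0)
  qed
  have w_shift: "?w (j + int r * C) = ?w j" for j C
    by (simp add: framed_def dvd_eq_mod_eq_0)
  have c: "\<forall>i \<in> {1..r - 1}. a i \<noteq> \<iota> n" using disj by auto
  have m_last: "int r * int (Suc m) = int r * int m + int r" by (simp add: algebra_simps)
  note copyI = contains_copy_if_run[OF r inj c fits]
  consider (late) "E \<le> k + 1" | (early) "k + int r \<le> S" | (middle) "S < k + int r" "k + 1 < E"
    by linarith
  then show ?thesis
  proof cases
    case late
    \<comment> \<open>Skipping \<open>k + 1 - E\<close> periods, a crude bound, carries every place from \<open>E\<close> on beyond \<open>k\<close>;
      the final \<open>+ 1\<close> accounts for the inserted letter.\<close>
    define e where "e j = (if j < int r * int m then S + j else if j = int r * int m then k + 1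
      else S + j + int r * (k + 1 - E) + 1)" for j
    have skip: "k + 1 - E \<le> int r * (k + 1 - E)" using late r by (simp add: mult_le_cancel_right1)
    show ?thesis
    proof (rule copyI)
      show "strict_mono_on {j. int r dvd j \<longrightarrow> 0 \<le> j \<and> j < int r * int (Suc m)} e"
        using late skip by (intro strict_mono_onI) (auto simp: e_def E_def)
    next
      fix j assume j: "int r dvd j \<Longrightarrow> 0 \<le> j \<and> j < int r * int (Suc m)"
      consider "j < int r * int m" | "j = int r * int m" | "int r * int m < j" by linarith
      then show "?t (e j) = ?w j"
      proof cases
        case 1
        then show ?thesis using run[of j] j late by (auto simp: e_def insert_after_def E_def)
      next
        case 2
        then show ?thesis by (simp add: e_def insert_after_def framed_def)
      next
        case 3
        have nd: "\<not> int r dvd j"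
        proof
          assume "int r dvd j"
          then have "int r dvd j - int r * int m" by simp
          then have "int r \<le> j - int r * int m" using 3 by (intro zdvd_imp_le) auto
          then show False using j[OF \<open>int r dvd j\<close>] m_last by simp
        qed
        then have "?s (S + j + int r * (k + 1 - E)) = ?w j"
          by (rule frame)
        then show ?thesis using 3 skip by (simp add: e_def insert_after_def E_def)
      qed
    qed
  next
    case early
    \<comment> \<open>The new letter opens the run, so the old run is read one period later than its places in the
      abstract run; the frame before it is moved back by \<open>S - k\<close> periods.\<close>
    define e where "e j = (if j < 0 then S + j + int r * (k - S) else if j = 0 then k + 1
      else S + j - int r + 1)" for j
    have skip: "int r * (k - S) \<le> k - S" using early r by (simp add: mult_le_cancel_right2)
    show ?thesis
    proof (rule copyI)
      show "strict_mono_on {j. int r dvd j \<longrightarrow> 0 \<le> j \<and> j < int r * int (Suc m)} e"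
        using early skip by (intro strict_mono_onI) (auto simp: e_def)
    next
      fix j assume j: "int r dvd j \<Longrightarrow> 0 \<le> j \<and> j < int r * int (Suc m)"
      consider "j < 0" | "j = 0" | "0 < j" by linarith
      then show "?t (e j) = ?w j"
      proof cases
        case 1
        then have "\<not> int r dvd j" using j by auto
        then have "?s (S + j + int r * (k - S)) = ?w j"
          by (rule frame)
        then show ?thesis using 1 skip by (simp add: e_def insert_after_def)
      next
        case 2
        then show ?thesis by (simp add: e_def insert_after_def framed_def)
      next
        case 3
        have "?s (S + (j - int r)) = ?w (j - int r)"
        proof (rule run)
          assume "int r dvd j - int r"
          then have "int r dvd j" by (metis dvd_add_triv_right_iff diff_add_cancel)
          then show "0 \<le> j - int r \<and> j - int r < int r * int m"
            using j 3 zdvd_imp_le[of "int r" j] m_last by auto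
        qed
        then have "?s (S + j - int r) = ?w j"
          using w_shift[of j "-1"] by (simp add: algebra_simps)
        then show ?thesis using 3 early by (simp add: e_def insert_after_def)
      qed
    qed
  next
    case middle
    have old: "?s (S + int r * q) = \<iota> n" if "0 \<le> q" "q < int m" for q
      using run[of "int r * q"] that r by (simp add: framed_def)
    have "S \<le> k"
    proof (rule ccontr)
      assume "\<not> S \<le> k"
      moreover have "?s S = \<iota> n" using old[of 0] m by simp
      ultimately show False using sparse_insert_distance(2)[of r ?s k S] sp middle by simp
    qed
    \<comment> \<open>The new letter is at most \<open>r\<close> places after the last old \<open>\<iota> n\<close> preceding it, which is
      the one in period \<open>q\<close> of the run.\<close>
    define q where "q = (k - S) div int r"
    have q: "int r * q \<le> k - S" "k - S < int r * q + int r"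
      using r by (simp_all add: q_def) (smt (verit) mult_div_mod_eq pos_mod_bound pos_mod_sign
        of_nat_0_less_iff)+
    have "0 \<le> q" using \<open>S \<le> k\<close> r by (simp add: q_def pos_imp_zdiv_nonneg_iff)
    have "int r * q < int r * int m" using q middle unfolding E_def by linarith
    then have "q < int m" using r by simp
    have "r = 1"
    proof (cases "q + 1 < int m")
      case True
      have "r \<le> 1"
        using sparse_insert_between[OF sp, of "S + int r * q"] old[of q] old[of "q + 1"]
          \<open>0 \<le> q\<close> True q by (simp add: algebra_simps)
      then show ?thesis using r by simp
    next
      case False
      then have "int m = q + 1" using \<open>q < int m\<close> by linarith
      then have "int r * q + int r = int r * int m" by (simp add: algebra_simps)
      then show ?thesis
        using sparse_insert_distance(1)[of r ?s k "S + int r * q"] sp old[of q] \<open>0 \<le> q\<close> \<open>q < int m\<close>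
          q middle by (simp add: E_def)
    qed
    show ?thesis
    proof (rule copyI)
      show "strict_mono_on {j. int r dvd j \<longrightarrow> 0 \<le> j \<and> j < int r * int (Suc m)} (\<lambda>j. S + j)"
        by (simp add: strict_mono_on_def)
    next
      fix j assume "int r dvd j \<Longrightarrow> 0 \<le> j \<and> j < int r * int (Suc m)"
      then have j: "0 \<le> j" "j \<le> int m" using \<open>r = 1\<close> by auto
      have "?t (S + j) = \<iota> n"
        using old[of j] old[of "j - 1"] j \<open>r = 1\<close> \<open>S \<le> k\<close> middle
        by (auto simp: insert_after_def E_def algebra_simps)
      then show "?t (S + j) = ?w j" using \<open>r = 1\<close> by (simp add: framed_def)
    qed
  qed
qed

section \<open>Existence of a saturated sequence\<close>

theorem theorem5:
  fixes u :: "'b list" and r :: nat and a :: "nat \<Rightarrow> 'a" and \<iota> :: "int \<Rightarrow> 'a"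
  assumes "u \<noteq> []"
    and "card (set u) = r"
    and "strongly_irreducible u"
    and "\<forall>x \<in> set u. count_list u x > 1"
    and "inj \<iota>"
    and "inj_on a {1..r - 1}"
    and "\<forall>i \<in> {1..r - 1}. a i \<notin> range \<iota>"
  shows "\<exists>s :: int \<Rightarrow> 'a. saturated u (a ` {1..r - 1} \<union> range \<iota>) s"
proof -
  have r: "0 < r" using assms(1,2) by (metis card_gt_0_iff finite_set set_empty)
  obtain m where m: "0 < m" "\<not> fits_run u r m" "fits_run u r (Suc m)"
    using exists_maximal_unfit_run[OF assms(1,2,4)] .
  let ?s = "framed a r (\<lambda>q. \<iota> (q div int m))"
  have "range ?s \<subseteq> a ` {1..r - 1} \<union> range \<iota>"
    using range_framed_subset[OF r, of a "\<lambda>q. \<iota> (q div int m)"] by blast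
  moreover have "sparse r ?s" using sparse_framed[OF r assms(6,7)] .
  moreover have "\<not> contains_copy u ?s"
    using no_copy_in_framed_runs[OF r assms(6,7,5,3) m(1,2)] .
  moreover have "\<not> sparse r (insert_after ?s k x) \<or> contains_copy u (insert_after ?s k x)"
    if "x \<in> a ` {1..r - 1} \<union> range \<iota>" for k x
    using that not_sparse_insert_frame_letter
      insert_run_letter_contains_copy[OF r assms(6,7) m(1,3)] by blast
  ultimately show ?thesis unfolding saturated_def assms(2) by blast
qed

end
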